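(* There exists no minimal filling pair on $N_1$, the closed non-orientable surface of genus $1$ (the real projective plane).
   Context: A simple closed curve is essential if it does not bound a disk or a Möbius strip; for $N_1$ the core curve of the crosscap is regarded as the unique essential simple closed curve up to free homotopy. A filling pair on a closed surface $S$ is a pair $\{\alpha,\beta\}$ of essential simple closed curves that are not freely homotopic (homotopically distinct, ignoring orientation), are in minimal position (i.e. $|\alpha\cap\beta|=i(\alpha,\beta)$, the geometric intersection number), and such that every component of $S\setminus(\alpha\cup\beta)$ is an open disk. A filling pair on the closed non-orientable surface $N_g$ of genus $g$ is minimal if $i(\alpha,\beta)=g-1$, equivalently if its complement is a single open disk. *)

theory Defs
  imports "HOL-Analysis.Analysis" "HOL-Library.Extended_Nat"
begin

text \<open>
  \<open>quotient_by Y R X q\<close>: the map \<open>q\<close> exhibits the space \<open>X\<close> as the quotient \<open>Y / R\<close>. Since \<open>X\<close>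
  is determined by this only up to homeomorphism, glued spaces are described here by a
  predicate on \<open>X\<close>; lemma \<open>quotient_by_exists\<close> provides a model.
\<close>

definition quotient_by ::
  "'b topology \<Rightarrow> ('b \<Rightarrow> 'b \<Rightarrow> bool) \<Rightarrow> 'a topology \<Rightarrow> ('b \<Rightarrow> 'a) \<Rightarrow> bool" where
  "quotient_by Y R X q \<longleftrightarrow>
     quotient_map Y X q \<and>
     (\<forall>x\<in>topspace Y. \<forall>y\<in>topspace Y. q x = q y \<longleftrightarrow> R x y)"

definition real_projective_plane :: "'a topology \<Rightarrow> bool" where
  "real_projective_plane X \<longleftrightarrow>
     (\<exists>q. quotient_by (top_of_set (sphere (0 :: real ^ 3) 1)) (\<lambda>x y. y = x \<or> y = - x) X q)"

abbreviation circle :: "complex set" where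
  "circle \<equiv> sphere 0 1"

definition simple_closed_curve :: "'a topology \<Rightarrow> (complex \<Rightarrow> 'a) \<Rightarrow> bool" where
  "simple_closed_curve X \<gamma> \<longleftrightarrow> embedding_map (top_of_set circle) X \<gamma>"

text \<open>Precomposition with \<open>cnj\<close> reverses the orientation of a curve.\<close>

definition freely_homotopic ::
  "'a topology \<Rightarrow> (complex \<Rightarrow> 'a) \<Rightarrow> (complex \<Rightarrow> 'a) \<Rightarrow> bool" where
  "freely_homotopic X \<gamma> \<delta> \<longleftrightarrow>
     homotopic_with (\<lambda>_. True) (top_of_set circle) X \<gamma> \<delta> \<or>
     homotopic_with (\<lambda>_. True) (top_of_set circle) X \<gamma> (\<delta> \<circ> cnj)"

definition bounds_disk :: "'a topology \<Rightarrow> (complex \<Rightarrow> 'a) \<Rightarrow> bool" where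
  "bounds_disk X \<gamma> \<longleftrightarrow>
     (\<exists>f. embedding_map (top_of_set (cball (0 :: complex) 1)) X f \<and> f ` circle = \<gamma> ` circle)"

text \<open>
  The Moebius strip is the rectangle \<open>[0,1] \<times> [-1,1]\<close> with \<open>(0,t)\<close> glued to \<open>(1,-t)\<close>; its boundary
  circle is the image of the two edges \<open>t = -1\<close> and \<open>t = 1\<close>.
\<close>

definition moebius_glue :: "real \<times> real \<Rightarrow> real \<times> real \<Rightarrow> bool" where
  "moebius_glue x y \<longleftrightarrow>
     x = y \<or> (fst x = 0 \<and> fst y = 1 \<or> fst x = 1 \<and> fst y = 0) \<and> snd y = - snd x"

definition bounds_moebius_strip :: "'a topology \<Rightarrow> (complex \<Rightarrow> 'a) \<Rightarrow> bool" where
  "bounds_moebius_strip X \<gamma> \<longleftrightarrow>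
     (\<exists>M f. M \<subseteq> topspace X \<and>
        quotient_by (top_of_set ({0..1} \<times> {-1..1})) moebius_glue (subtopology X M) f \<and>
        f ` ({0..1} \<times> {-1, 1}) = \<gamma> ` circle)"

text \<open>
  In the projective plane a two-sided simple closed curve bounds a disk (and, on its other side, a
  Moebius strip), while a one-sided curve, being non-separating, is the boundary of neither.
  So the essential curves of the projective plane are exactly those homotopic to the core of
  the crosscap, which agrees with the usual convention for this surface.
\<close>

definition essential :: "'a topology \<Rightarrow> (complex \<Rightarrow> 'a) \<Rightarrow> bool" where
  "essential X \<gamma> \<longleftrightarrow>
     simple_closed_curve X \<gamma> \<and> \<not> bounds_disk X \<gamma> \<and> \<not> bounds_moebius_strip X \<gamma>"

text \<open>Values are in \<open>enat\<close>, since \<open>card\<close> of an infinite set is \<open>0\<close>.\<close>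

definition crossings :: "(complex \<Rightarrow> 'a) \<Rightarrow> (complex \<Rightarrow> 'a) \<Rightarrow> enat" where
  "crossings \<alpha> \<beta> =
     (if finite (\<alpha> ` circle \<inter> \<beta> ` circle) then enat (card (\<alpha> ` circle \<inter> \<beta> ` circle)) else \<infinity>)"

definition intersection_number ::
  "'a topology \<Rightarrow> (complex \<Rightarrow> 'a) \<Rightarrow> (complex \<Rightarrow> 'a) \<Rightarrow> enat" where
  "intersection_number X \<alpha> \<beta> =
     Inf {crossings \<alpha>' \<beta>' | \<alpha>' \<beta>'.
            simple_closed_curve X \<alpha>' \<and> freely_homotopic X \<alpha> \<alpha>' \<and>
            simple_closed_curve X \<beta>' \<and> freely_homotopic X \<beta> \<beta>'}"

definition open_disk :: "'a topology \<Rightarrow> bool" where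
  "open_disk Y \<longleftrightarrow> Y homeomorphic_space top_of_set (ball (0 :: complex) 1)"

definition filling_pair :: "'a topology \<Rightarrow> (complex \<Rightarrow> 'a) \<Rightarrow> (complex \<Rightarrow> 'a) \<Rightarrow> bool" where
  "filling_pair X \<alpha> \<beta> \<longleftrightarrow>
     essential X \<alpha> \<and> essential X \<beta> \<and>
     \<not> freely_homotopic X \<alpha> \<beta> \<and>
     crossings \<alpha> \<beta> = intersection_number X \<alpha> \<beta> \<and>
     (\<forall>C \<in> connected_components_of
             (subtopology X (topspace X - (\<alpha> ` circle \<union> \<beta> ` circle))).
        open_disk (subtopology X C))"

text \<open>Here \<open>g \<ge> 1\<close> is the genus of the closed non-orientable surface \<open>X\<close>.\<close>

definition minimal_filling_pair ::
  "nat \<Rightarrow> 'a topology \<Rightarrow> (complex \<Rightarrow> 'a) \<Rightarrow> (complex \<Rightarrow> 'a) \<Rightarrow> bool" where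
  "minimal_filling_pair g X \<alpha> \<beta> \<longleftrightarrow>
     filling_pair X \<alpha> \<beta> \<and> intersection_number X \<alpha> \<beta> = enat (g - 1)"

lemma quotient_by_exists:
  fixes Y :: "'b topology" and R :: "'b \<Rightarrow> 'b \<Rightarrow> bool"
  assumes "equivp R"
  shows "\<exists>X :: 'b set topology. quotient_by Y R X (\<lambda>x. {y. R x y})"
proof -
  define q where "q = (\<lambda>x. {y. R x y})"
  define P where "P = (\<lambda>U. U \<subseteq> q ` topspace Y \<and> openin Y {x \<in> topspace Y. q x \<in> U})"
  have "istopology P"
    unfolding istopology_def
  proof (intro conjI allI impI)
    fix S T assume "P S" "P T"
    then have "openin Y ({x \<in> topspace Y. q x \<in> S} \<inter> {x \<in> topspace Y. q x \<in> T})"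
      unfolding P_def by blast
    moreover have "{x \<in> topspace Y. q x \<in> S} \<inter> {x \<in> topspace Y. q x \<in> T}
        = {x \<in> topspace Y. q x \<in> S \<inter> T}" by blast
    ultimately show "P (S \<inter> T)" using \<open>P S\<close> unfolding P_def by auto
  next
    fix K assume K: "\<forall>k\<in>K. P k"
    then have "openin Y (\<Union>k\<in>K. {x \<in> topspace Y. q x \<in> k})"
      unfolding P_def by blast
    moreover have "(\<Union>k\<in>K. {x \<in> topspace Y. q x \<in> k}) = {x \<in> topspace Y. q x \<in> \<Union>K}" by blast
    ultimately show "P (\<Union>K)" using K unfolding P_def by auto
  qed
  then have op: "openin (topology P) = P"
    by (simp add: topology_inverse')
  have "{x \<in> topspace Y. q x \<in> q ` topspace Y} = topspace Y"
    by blast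
  then have "P (q ` topspace Y)"
    unfolding P_def by simp
  then have "openin (topology P) (q ` topspace Y)"
    unfolding op .
  moreover have "U \<subseteq> q ` topspace Y" if "openin (topology P) U" for U
    using that[unfolded op] unfolding P_def by (rule conjunct1)
  ultimately have top: "topspace (topology P) = q ` topspace Y"
    by (intro subset_antisym openin_subset) auto
  have "openin (topology P) U \<longleftrightarrow> openin Y {x \<in> topspace Y. q x \<in> U}"
    if "U \<subseteq> q ` topspace Y" for U
    unfolding op unfolding P_def by (simp only: that simp_thms)
  with top have "quotient_map Y (topology P) q"
    unfolding quotient_map_def by metis
  moreover have "q x = q y \<longleftrightarrow> R x y" for x y
    using assms unfolding q_def equivp_def by (metis Collect_inj)
  ultimately show ?thesis
    unfolding quotient_by_def q_def by blast
qed

lemma real_projective_plane_exists: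
  "\<exists>X :: (real ^ 3) set topology. real_projective_plane X"
proof -
  have "equivp (\<lambda>x y :: real ^ 3. y = x \<or> y = - x)"
    by (intro equivpI) (auto simp: reflp_def symp_def transp_def)
  from quotient_by_exists[OF this] show ?thesis
    unfolding real_projective_plane_def by blast
qed

end

theory Submission imports Defs begin

text \<open>
  Curves meeting in \<open>g - 1 = 0\<close> points are disjoint, so it suffices that a closed set \<open>K\<close> whose
  complementary components are open disks is connected. An open disk has one end, so when \<open>K\<close> is
  the union of disjoint closed sets \<open>A\<close> and \<open>B\<close>, each complementary disk accumulates at only one
  of the two. By local connectedness, \<open>A\<close> together with the disks accumulating at it is open, and
  likewise for \<open>B\<close>; this would disconnect the surface.
\<close>

section \<open>The end of an open disk\<close>

text \<open>In the unit disk a compact set lies in a concentric closed disk of radius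
  \<open>r < 1\<close>, and what remains outside it is an annulus, which is connected in real
  dimension 2.\<close>

lemma open_disk_one_ended:
  assumes Y: "open_disk Y" and K: "compactin Y K"
  obtains D where "compactin Y D" "K \<subseteq> D" "connectedin Y (topspace Y - D)"
proof -
  obtain h k where h: "continuous_map Y (top_of_set (ball (0::complex) 1)) h"
    and k: "continuous_map (top_of_set (ball (0::complex) 1)) Y k"
    and kh: "\<And>x. x \<in> topspace Y \<Longrightarrow> k (h x) = x"
    and hk: "\<And>z. z \<in> ball 0 1 \<Longrightarrow> h (k z) = z"
    using Y unfolding open_disk_def homeomorphic_space_def homeomorphic_maps_def by auto
  have hY: "h x \<in> ball 0 1" if "x \<in> topspace Y" for x
    using continuous_map_funspace[OF h] that by auto
  have kY: "k z \<in> topspace Y" if "z \<in> ball 0 1" for z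
    using continuous_map_funspace[OF k] that by auto
  have KY: "K \<subseteq> topspace Y"
    using K compactin_subset_topspace by blast
  have "compactin (top_of_set (ball 0 1)) (h ` K)"
    using image_compactin[OF K h] .
  then have hK: "compact (h ` K)" "h ` K \<subseteq> ball 0 1"
    by (auto simp: compactin_subtopology)
  obtain r where r: "r < 1" "h ` K \<subseteq> cball 0 r"
  proof (cases "K = {}")
    case True
    then show ?thesis using that[of 0] by auto
  next
    case False
    then obtain m where m: "m \<in> h ` K" "\<forall>z\<in>h ` K. norm z \<le> norm m"
      using continuous_attains_sup[OF hK(1), of norm] continuous_on_norm_id by auto
    show ?thesis
      by (rule that[of "norm m"]) (use m hK(2) in auto)
  qed
  define D where "D = k ` cball 0 r"
  have sub: "cball (0::complex) r \<subseteq> ball 0 1"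
    using r by auto
  have "compactin Y D"
    unfolding D_def
    by (rule image_compactin[OF _ k]) (use sub in \<open>auto simp: compactin_subtopology\<close>)
  moreover have "K \<subseteq> D"
  proof
    fix x assume "x \<in> K"
    then have "h x \<in> cball 0 r" "k (h x) = x"
      using r KY kh by auto
    then show "x \<in> D" unfolding D_def by (metis imageI)
  qed
  \<comment> \<open>The term \<open>z - 0\<close> fits the annulus to the form of
    \<open>connected_annulus\<close>.\<close>
  moreover have "topspace Y - D = k ` {z. r < norm (z - 0) \<and> norm (z - 0) < 1}"
  proof (intro equalityI subsetI)
    fix x assume x: "x \<in> topspace Y - D"
    then have "h x \<notin> cball 0 r"
      unfolding D_def using kh by (metis DiffD1 DiffD2 imageI)
    then show "x \<in> k ` {z. r < norm (z - 0) \<and> norm (z - 0) < 1}"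
      using x hY[of x] kh[of x] by (intro image_eqI[of _ _ "h x"]) auto
  next
    fix x assume "x \<in> k ` {z. r < norm (z - 0) \<and> norm (z - 0) < 1}"
    then obtain z where z: "x = k z" "r < norm z" "norm z < 1" by auto
    have "x \<notin> D"
    proof
      assume "x \<in> D"
      then obtain w where w: "w \<in> cball 0 r" "k z = k w" unfolding D_def z by auto
      have "z = h (k z)" using hk z by simp
      also have "\<dots> = w" unfolding w(2) using hk w(1) sub by blast
      finally show False using w z by simp
    qed
    moreover have "x \<in> topspace Y" unfolding z(1) by (rule kY) (use z in simp)
    ultimately show "x \<in> topspace Y - D" by blast
  qed
  moreover have "connectedin Y (k ` {z. r < norm (z - 0) \<and> norm (z - 0) < 1})"
  proof (rule connectedin_continuous_map_image[OF k])
    have "connected {z::complex. r < norm (z - 0) \<and> norm (z - 0) < 1}"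
      by (rule connected_annulus) simp
    moreover have "{z::complex. r < norm (z - 0) \<and> norm (z - 0) < 1} \<subseteq> ball 0 1"
      by auto
    ultimately show "connectedin (top_of_set (ball 0 1)) {z::complex. r < norm (z - 0) \<and> norm (z - 0) < 1}"
      by (simp only: connectedin_subtopology connectedin_iff_connected simp_thms)
  qed
  ultimately show thesis
    using that by metis
qed

section \<open>Complementary components and their limit points\<close>

text \<open>Components are closed in their space, so limit points of \<open>C\<close> outside
  \<open>C\<close> cannot lie in the complement of \<open>K\<close>.\<close>

lemma closure_of_complementary_component:
  assumes "C \<in> connected_components_of (subtopology X (topspace X - K))"
  shows "X closure_of C \<subseteq> C \<union> K"
proof -
  obtain T where "closedin X T" "C = T \<inter> (topspace X - K)"
    using closedin_connected_components_of[OF assms] by (auto simp: closedin_subtopology)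
  then show ?thesis
    using closure_of_minimal[of C T X] closedin_subset[of X T] by blast
qed

text \<open>Otherwise \<open>C\<close> would be closed, and by local connectedness it is open;
  connectedness would make it all of \<open>X\<close>, leaving no room for \<open>K\<close>.\<close>

lemma complementary_component_meets_closed:
  assumes X: "connected_space X" "locally_connected_space X"
    and K: "closedin X K" "K \<noteq> {}"
    and C: "C \<in> connected_components_of (subtopology X (topspace X - K))"
  shows "X closure_of C \<inter> K \<noteq> {}"
proof
  assume *: "X closure_of C \<inter> K = {}"
  have op: "openin X (topspace X - K)" using K by blast
  have "openin X C"
    using locally_connected_space_open_connected_components X(2) op C by blast
  moreover have CX: "C \<subseteq> topspace X - K"
    using connected_components_of_subset[OF C] by auto
  moreover have "X closure_of C = C"
    using * closure_of_complementary_component[OF C] closure_of_subset[of C X] CX by blast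
  then have "closedin X C" by (metis closedin_closure_of)
  moreover have "C \<noteq> {}" using nonempty_connected_components_of[OF C] .
  ultimately have "C = topspace X" using X(1) by (auto simp: connected_space_clopen_in)
  then show False using CX K closedin_subset by blast
qed

text \<open>Separate \<open>A\<close> and \<open>B\<close> by disjoint open \<open>V\<close> and
  \<open>W\<close>. The part of \<open>C\<close> outside both is compact, so off a larger compact
  subset the disk is still connected; accumulation at both sets would let \<open>V\<close> and
  \<open>W\<close> split that remainder.\<close>

lemma open_disk_component_one_side:
  assumes X: "compact_space X" "Hausdorff_space X"
    and AB: "closedin X A" "closedin X B" "A \<inter> B = {}"
    and C: "C \<in> connected_components_of (subtopology X (topspace X - (A \<union> B)))"
    and disk: "open_disk (subtopology X C)"
  shows "X closure_of C \<inter> A = {} \<or> X closure_of C \<inter> B = {}"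
proof (rule ccontr)
  assume "\<not> ?thesis"
  then obtain a b where ab: "a \<in> A" "a \<in> X closure_of C" "b \<in> B" "b \<in> X closure_of C" by blast
  have CX: "C \<subseteq> topspace X - (A \<union> B)"
    using connected_components_of_subset[OF C] by auto
  have "normal_space X"
    using X compact_Hausdorff_or_regular_imp_normal_space by blast
  then obtain V W where VW: "openin X V" "openin X W" "A \<subseteq> V" "B \<subseteq> W" "V \<inter> W = {}"
    using AB unfolding normal_space_def disjnt_def by metis
  define F where "F = X closure_of C \<inter> (topspace X - (V \<union> W))"
  \<comment> \<open>Passing to the closure of \<open>C\<close> adds only points of \<open>A\<close>
    and \<open>B\<close>, which \<open>V\<close> and \<open>W\<close> absorb. So \<open>F\<close> is
    closed in \<open>X\<close> and yet inside \<open>C\<close>.\<close>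
  have FC: "F = C - (V \<union> W)"
    unfolding F_def using closure_of_complementary_component[OF C] closure_of_subset[of C X] CX VW
    by blast
  have "closedin X F"
    unfolding F_def using VW by (intro closedin_Int closedin_closure_of closedin_diff closedin_topspace openin_Un)
  then have "compactin X F" using X closedin_compact_space by blast
  then have "compactin (subtopology X C) F"
    using FC by (auto simp: compactin_subtopology)
  then obtain D where D: "compactin (subtopology X C) D" "F \<subseteq> D"
      "connectedin (subtopology X C) (topspace (subtopology X C) - D)"
    using open_disk_one_ended[OF disk] by metis
  have "topspace (subtopology X C) = C" using CX by auto
  with D(3) have conn: "connectedin X (C - D)" by (simp add: connectedin_subtopology)
  have DC: "compactin X D" "D \<subseteq> C" using D(1) by (auto simp: compactin_subtopology)
  then have clD: "closedin X D" using X compactin_imp_closedin by blast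
  \<comment> \<open>\<open>D\<close> is closed in \<open>X\<close> and misses \<open>A\<close> and
    \<open>B\<close>, so removing it leaves neighbourhoods of \<open>a\<close> and \<open>b\<close>,
    which the limit points force to meet \<open>C\<close>.\<close>
  have "a \<in> V - D" "openin X (V - D)" "b \<in> W - D" "openin X (W - D)"
    using ab VW DC CX clD by auto
  then have "\<exists>y\<in>C. y \<in> V - D" "\<exists>y\<in>C. y \<in> W - D"
    using ab unfolding in_closure_of by blast+
  then have "V \<inter> (C - D) \<noteq> {}" "W \<inter> (C - D) \<noteq> {}" by auto
  moreover have "C - D \<subseteq> V \<union> W" "V \<inter> W \<inter> (C - D) = {}" using FC D(2) VW(5) by auto
  ultimately show False
    using conn VW(1,2) unfolding connectedin by metis
qed

text \<open>Components are open, so only points of \<open>A\<close> need care: a connected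
  neighbourhood that avoids \<open>B\<close> can meet only components accumulating at
  \<open>A\<close>.\<close>

lemma openin_closed_Un_adjacent_components:
  assumes X: "locally_connected_space X"
    and AB: "closedin X A" "closedin X B" "A \<inter> B = {}"
  defines "\<C> \<equiv> connected_components_of (subtopology X (topspace X - (A \<union> B)))"
  shows "openin X (A \<union> \<Union>{C \<in> \<C>. X closure_of C \<inter> A \<noteq> {}})" (is "openin X ?P")
proof (subst openin_subopen, intro ballI)
  fix x assume x: "x \<in> ?P"
  have op: "openin X (topspace X - (A \<union> B))" using AB by blast
  have opC: "openin X C" if "C \<in> \<C>" for C
    using locally_connected_space_open_connected_components X op that unfolding \<C>_def by blast
  show "\<exists>T. openin X T \<and> x \<in> T \<and> T \<subseteq> ?P"
  proof (cases "x \<in> A")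
    case False
    then obtain C where "C \<in> \<C>" "X closure_of C \<inter> A \<noteq> {}" "x \<in> C" using x by auto
    then show ?thesis using opC by blast
  next
    case True
    have "openin X (topspace X - B)" "x \<in> topspace X - B"
      using AB True closedin_subset by blast+
    then obtain W where W: "openin X W" "connectedin X W" "x \<in> W" "W \<subseteq> topspace X - B"
      using X unfolding locally_connected_space by metis
    have "W \<subseteq> ?P"
    proof
      fix y assume y: "y \<in> W"
      show "y \<in> ?P"
      proof (cases "y \<in> A")
        case False
        then have "y \<in> \<Union>\<C>"
          unfolding \<C>_def Union_connected_components_of using y W by auto
        then obtain C where C: "C \<in> \<C>" "y \<in> C" by auto
        have "C \<subseteq> topspace X - (A \<union> B)"
          using connected_components_of_subset C(1) unfolding \<C>_def by force
        then have "W - C \<noteq> {}" using W True by auto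
        \<comment> \<open>The connected set \<open>W\<close> contains \<open>y\<close> in
          \<open>C\<close> and \<open>x\<close> outside it, so it crosses the frontier of
          \<open>C\<close>. The crossing point lies in \<open>A\<close> or \<open>B\<close>, and
          \<open>W\<close> misses \<open>B\<close>.\<close>
        then have "W \<inter> X frontier_of C \<noteq> {}"
          using connectedin_Int_frontier_of W(2) y C by blast
        then obtain z where "z \<in> W" "z \<in> X closure_of C" "z \<notin> C"
          using opC[OF C(1)] by (auto simp: frontier_of_def interior_of_openin)
        moreover then have "z \<in> A"
          using closure_of_complementary_component C(1) W unfolding \<C>_def by blast
        ultimately show ?thesis using C by auto
      qed auto
    qed
    then show ?thesis using W by blast
  qed
qed

section \<open>Connectedness of a set with open disks as complement\<close>

lemma connectedin_if_complement_open_disks: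
  assumes X: "compact_space X" "Hausdorff_space X" "connected_space X" "locally_connected_space X"
    and K: "closedin X K"
    and disks: "\<And>C. C \<in> connected_components_of (subtopology X (topspace X - K))
                  \<Longrightarrow> open_disk (subtopology X C)"
  shows "connectedin X K"
proof (rule ccontr)
  assume "\<not> connectedin X K"
  then obtain E F where E: "closedin X E" "closedin X F" "K \<subseteq> E \<union> F" "E \<inter> F \<inter> K = {}"
      "E \<inter> K \<noteq> {}" "F \<inter> K \<noteq> {}"
    using K closedin_subset unfolding connectedin_closedin by metis
  define A B where "A = E \<inter> K" and "B = F \<inter> K"
  have AB: "closedin X A" "closedin X B" "A \<inter> B = {}" "A \<noteq> {}" "B \<noteq> {}" "K = A \<union> B"
    using E K unfolding A_def B_def by auto
  define \<C> where "\<C> = connected_components_of (subtopology X (topspace X - (A \<union> B)))"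
  define P where "P = A \<union> \<Union>{C \<in> \<C>. X closure_of C \<inter> A \<noteq> {}}"
  define Q where "Q = B \<union> \<Union>{C \<in> \<C>. X closure_of C \<inter> B \<noteq> {}}"
  have "openin X P"
    using openin_closed_Un_adjacent_components[OF X(4) AB(1,2,3)] unfolding P_def \<C>_def .
  moreover have "openin X Q"
    using openin_closed_Un_adjacent_components[OF X(4) AB(2,1)] AB(3)
    unfolding Q_def \<C>_def by (simp add: Int_commute Un_commute)
  moreover have "topspace X \<subseteq> P \<union> Q"
  proof
    fix x assume x: "x \<in> topspace X"
    show "x \<in> P \<union> Q"
    proof (cases "x \<in> A \<union> B")
      case True
      then show ?thesis unfolding P_def Q_def by blast
    next
      case False
      then have "x \<in> \<Union>\<C>"
        unfolding \<C>_def Union_connected_components_of using x by auto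
      then obtain C where C: "C \<in> \<C>" "x \<in> C" by auto
      \<comment> \<open>Every component accumulates somewhere on \<open>K\<close>, so it is
        collected in \<open>P\<close> or in \<open>Q\<close>.\<close>
      then have "X closure_of C \<inter> (A \<union> B) \<noteq> {}"
        using complementary_component_meets_closed[OF X(3,4) K] AB(4,6) unfolding \<C>_def by auto
      then show ?thesis using C unfolding P_def Q_def by blast
    qed
  qed
  \<comment> \<open>The disk hypothesis enters here: a component in both \<open>P\<close> and
    \<open>Q\<close> would accumulate at both \<open>A\<close> and \<open>B\<close>.\<close>
  moreover have "P \<inter> Q = {}"
  proof -
    have sub: "C \<inter> (A \<union> B) = {}" if "C \<in> \<C>" for C
      using connected_components_of_subset that unfolding \<C>_def by force
    have one: "X closure_of C \<inter> A = {} \<or> X closure_of C \<inter> B = {}" if "C \<in> \<C>" for C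
      using open_disk_component_one_side[OF X(1,2) AB(1-3)] disks that AB(6)
      unfolding \<C>_def by blast
    have "C \<inter> C' = {}" if "C \<in> \<C>" "C' \<in> \<C>" "C \<noteq> C'" for C C'
      using connected_components_of_disjoint that unfolding \<C>_def disjnt_def by blast
    with sub one show ?thesis
      using AB(3) unfolding P_def Q_def by fast
  qed
  moreover have "P \<noteq> {}" "Q \<noteq> {}" using AB unfolding P_def Q_def by auto
  ultimately show False
    using X(3) unfolding connected_space_def by blast
qed

section \<open>Topology of the projective plane\<close>

text \<open>Compactness, connectedness and local connectedness descend along any quotient map from
  the sphere. The Hausdorff property does not in general; it comes from \<open>q\<close> being a
  closed map.\<close>

lemma real_projective_plane_surface:
  assumes "real_projective_plane X"
  shows "compact_space X" "Hausdorff_space X" "connected_space X" "locally_connected_space X"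
proof -
  let ?S = "sphere (0 :: real ^ 3) 1"
  obtain q where q: "quotient_map (top_of_set ?S) X q"
    and R: "\<And>x y. x \<in> ?S \<Longrightarrow> y \<in> ?S \<Longrightarrow> q x = q y \<longleftrightarrow> y = x \<or> y = - x"
    using assms unfolding real_projective_plane_def quotient_by_def by auto
  have cont: "continuous_map (top_of_set ?S) X q" and surj: "q ` ?S = topspace X"
    using q quotient_imp_continuous_map quotient_imp_surjective_map by fastforce+
  show "compact_space X"
    using compactin_subtopology image_compactin[OF _ cont, of ?S] surj
    by (simp add: compact_space_def compactin_subtopology)
  show "connected_space X"
    using connected_space_quotient_map_image[OF q]
    by (simp add: connected_space_subtopology connected_sphere)
  have "locally connected ?S" by (rule locally_connected_sphere)
  then have "locally_connected_space (top_of_set ?S)"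
    unfolding locally_connected locally_connected_space
    by (metis connectedin_subtopology connectedin_iff_connected openin_imp_subset)
  then show "locally_connected_space X"
    using locally_connected_space_quotient_map_image q by blast
  have closed: "closed_map (top_of_set ?S) X q"
    unfolding closed_map_def
  proof (intro allI impI)
    fix U assume "closedin (top_of_set ?S) U"
    then have U: "closed U" "U \<subseteq> ?S"
      by (auto simp: closedin_closed_eq)
    \<comment> \<open>Saturating \<open>U\<close> under the antipodal relation only adds its mirror
      image, which is again closed.\<close>
    have "{x \<in> ?S. q x \<in> q ` U} = U \<union> uminus ` U"
    proof (intro equalityI subsetI)
      fix x assume "x \<in> {x \<in> ?S. q x \<in> q ` U}"
      then obtain u where "x \<in> ?S" "u \<in> U" "q x = q u" by blast
      moreover then have "u = x \<or> u = - x" using R U(2) by blast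
      ultimately show "x \<in> U \<union> uminus ` U" by force
    next
      fix x assume x: "x \<in> U \<union> uminus ` U"
      then have "x \<in> ?S" "x \<in> U \<or> - x \<in> U" using U(2) by auto
      moreover then have "q (- x) = q x" using R[of x "- x"] by auto
      ultimately show "x \<in> {x \<in> ?S. q x \<in> q ` U}" by (metis (mono_tags) CollectI imageI)
    qed
    moreover have "closed (U \<union> uminus ` U)" using U closed_negations by auto
    moreover have "q ` U \<subseteq> topspace X" using U surj by auto
    ultimately show "closedin X (q ` U)"
      using q unfolding quotient_map_closedin by (auto simp: closedin_closed_eq)
  qed
  \<comment> \<open>Normality and closedness of points both pass through a continuous closed
    surjection, and together they give Hausdorff.\<close>
  have "normal_space (top_of_set ?S)"
    by (rule compact_Hausdorff_or_regular_imp_normal_space)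
      (auto simp: compact_space_subtopology Hausdorff_space_subtopology)
  then have "normal_space X"
    by (rule normal_space_continuous_closed_map_image[OF _ cont closed]) (simp add: surj)
  moreover have "t1_space X"
    unfolding t1_space_closedin_singleton
  proof
    fix y assume "y \<in> topspace X"
    then obtain x where x: "x \<in> ?S" "y = q x" using surj by (metis imageE)
    then have "closedin (top_of_set ?S) {x}" by (simp add: closedin_closed_eq)
    then have "closedin X (q ` {x})" using closed unfolding closed_map_def by blast
    then show "closedin X {y}" using x by simp
  qed
  ultimately show "Hausdorff_space X" by (rule normal_t1_imp_Hausdorff_space)
qed

section \<open>Two curves on the projective plane\<close>

lemma simple_closed_curve_closedin:
  assumes "Hausdorff_space X" "simple_closed_curve X \<gamma>"
  shows "closedin X (\<gamma> ` circle)"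
proof -
  have "continuous_map (top_of_set circle) X \<gamma>"
    using assms(2) unfolding simple_closed_curve_def
    by (metis embedding_map_def homeomorphic_imp_continuous_map continuous_map_in_subtopology)
  then have "compactin X (\<gamma> ` circle)"
    by (rule image_compactin[rotated]) (simp add: compactin_subtopology)
  then show ?thesis using assms(1) compactin_imp_closedin by blast
qed

theorem lemma3p4:
  fixes X :: "'a topology"
  assumes "real_projective_plane X"
  shows "\<not> (\<exists>\<alpha> \<beta>. minimal_filling_pair 1 X \<alpha> \<beta>)"
proof
  assume "\<exists>\<alpha> \<beta>. minimal_filling_pair 1 X \<alpha> \<beta>"
  then obtain \<alpha> \<beta> where "minimal_filling_pair 1 X \<alpha> \<beta>" by blast
  \<comment> \<open>For \<open>g = 1\<close> the required intersection number is
    \<open>enat (1 - 1)\<close>, and minimal position turns it into the actual number of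
    crossings.\<close>
  then have scc: "simple_closed_curve X \<alpha>" "simple_closed_curve X \<beta>"
    and cr: "crossings \<alpha> \<beta> = 0"
    and disks: "\<And>C. C \<in> connected_components_of
        (subtopology X (topspace X - (\<alpha> ` circle \<union> \<beta> ` circle))) \<Longrightarrow> open_disk (subtopology X C)"
    unfolding minimal_filling_pair_def filling_pair_def essential_def
    by (auto simp: zero_enat_def)
  note X = real_projective_plane_surface[OF assms]
  \<comment> \<open>An infinite intersection has value \<infinity> in \<open>crossings\<close>, so
    the value 0 really means that it is empty.\<close>
  have disj: "\<alpha> ` circle \<inter> \<beta> ` circle = {}"
    using cr unfolding crossings_def by (auto simp: zero_enat_def split: if_splits)
  have cl: "closedin X (\<alpha> ` circle)" "closedin X (\<beta> ` circle)"
    using simple_closed_curve_closedin X(2) scc by blast+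
  then have "connectedin X (\<alpha> ` circle \<union> \<beta> ` circle)"
    using connectedin_if_complement_open_disks[OF X] disks by blast
  moreover have "\<alpha> ` circle \<noteq> {}" "\<beta> ` circle \<noteq> {}"
    by auto
  ultimately show False
    using disj cl unfolding connectedin_closedin by blast
qed

end
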